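(* For every $(n,m)\in\mathbb{N}_0^2$, the $\mathcal{D}$-module $T(n,m)$ is uniserial and indecomposable.
   Context: $\Bbbk$ is an algebraically closed field of characteristic $0$; $\mathbb{N}_0=\{0,1,2,\dots\}$. $\mathcal{D}$ (the double of the Jordan plane) is the $\Bbbk$-algebra presented by generators $u, v, \xi, g, g^{-1}, x, y$ and relations $g g^{-1}=g^{-1}g=1$, $\xi g=g\xi$, $gx=xg$, $gy=yg+xg$, $\xi y=y\xi-2y$, $\xi x=x\xi-2x$, $ug=gu$, $vg=gv+gu$, $v\xi=\xi v-2v$, $u\xi=\xi u-2u$, $yx=xy-\tfrac12x^2$, $vu=uv-\tfrac12u^2$, $ux=xu$, $vx=xv+(1-g)+xu$, $uy=yu+(1-g)$, $vy=yv+\tfrac12 g\xi+yu$. Modules are left modules. For $(n,m)\in\mathbb{N}_0^2$, $T(n,m)$ is the $\mathcal{D}$-module presented by one generator $z$ with defining relations $g\cdot z=z$, $\xi\cdot z=(n+2m)z$, $u\cdot z=0$, $v\cdot z=0$, $x^{m+1}\cdot z=0$, and $y^{n+2(m-j)+1}x^j\cdot z=0$ for all $0\le j\le m$. A module is uniserial if its submodules are totally ordered by inclusion. *)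

theory Defs
  imports "HOL-Algebra.Algebraic_Closure_Type" "HOL-Library.Poly_Mapping"
begin

section \<open>Left modules over noncommutative rings\<close>

text \<open>
  The library locale \<^locale>\<open>module\<close> requires a commutative ring of scalars. Its record type and
  the locale \<^locale>\<open>submodule\<close> do not, and both are reused here. In module records the
  ring fields \<open>mult\<close> and \<open>one\<close> play no role.
\<close>

locale left_module = R?: ring R + M?: abelian_group M
  for R :: "('a, 'c) ring_scheme" (structure) and M :: "('a, 'b, 'd) module_scheme" (structure) +
  assumes smult_closed:
      "a \<in> carrier R \<Longrightarrow> x \<in> carrier M \<Longrightarrow> a \<odot>\<^bsub>M\<^esub> x \<in> carrier M"
    and smult_l_distr:
      "a \<in> carrier R \<Longrightarrow> b \<in> carrier R \<Longrightarrow> x \<in> carrier M \<Longrightarrow>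
        (a \<oplus> b) \<odot>\<^bsub>M\<^esub> x = a \<odot>\<^bsub>M\<^esub> x \<oplus>\<^bsub>M\<^esub> b \<odot>\<^bsub>M\<^esub> x"
    and smult_r_distr:
      "a \<in> carrier R \<Longrightarrow> x \<in> carrier M \<Longrightarrow> y \<in> carrier M \<Longrightarrow>
        a \<odot>\<^bsub>M\<^esub> (x \<oplus>\<^bsub>M\<^esub> y) = a \<odot>\<^bsub>M\<^esub> x \<oplus>\<^bsub>M\<^esub> a \<odot>\<^bsub>M\<^esub> y"
    and smult_assoc:
      "a \<in> carrier R \<Longrightarrow> b \<in> carrier R \<Longrightarrow> x \<in> carrier M \<Longrightarrow>
        (a \<otimes> b) \<odot>\<^bsub>M\<^esub> x = a \<odot>\<^bsub>M\<^esub> (b \<odot>\<^bsub>M\<^esub> x)"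
    and smult_one:
      "x \<in> carrier M \<Longrightarrow> \<one> \<odot>\<^bsub>M\<^esub> x = x"

definition uniserial :: "('a, 'c) ring_scheme \<Rightarrow> ('a, 'b, 'd) module_scheme \<Rightarrow> bool" where
  "uniserial R M \<longleftrightarrow>
     (\<forall>A B. submodule A R M \<longrightarrow> submodule B R M \<longrightarrow> A \<subseteq> B \<or> B \<subseteq> A)"

definition indecomposable :: "('a, 'c) ring_scheme \<Rightarrow> ('a, 'b, 'd) module_scheme \<Rightarrow> bool" where
  "indecomposable R M \<longleftrightarrow> carrier M \<noteq> {\<zero>\<^bsub>M\<^esub>} \<and>
     (\<forall>A B. submodule A R M \<longrightarrow> submodule B R M \<longrightarrow>
        A \<inter> B = {\<zero>\<^bsub>M\<^esub>} \<longrightarrow> A <+>\<^bsub>M\<^esub> B = carrier M \<longrightarrow>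
        A = {\<zero>\<^bsub>M\<^esub>} \<or> B = {\<zero>\<^bsub>M\<^esub>})"

definition regular_module :: "('a, 'c) ring_scheme \<Rightarrow> ('a, 'a) module" where
  "regular_module R =
     \<lparr>carrier = carrier R, monoid.mult = monoid.mult R, one = one R, ring.zero = ring.zero R, add = add R,
      module.smult = monoid.mult R\<rparr>"

definition gen_submodule ::
    "('a, 'c) ring_scheme \<Rightarrow> ('a, 'b, 'd) module_scheme \<Rightarrow> 'b set \<Rightarrow> 'b set" where
  "gen_submodule R M S = \<Inter>{N. submodule N R M \<and> S \<subseteq> N}"

definition quotient_module :: "('a, 'b, 'd) module_scheme \<Rightarrow> 'b set \<Rightarrow> ('a, 'b set) module" where
  "quotient_module M N =
     \<lparr>carrier = a_rcosets\<^bsub>M\<^esub> N, monoid.mult = undefined, one = undefined, ring.zero = N, add = set_add M,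
      module.smult = (\<lambda>a C. \<Union>x\<in>C. N +>\<^bsub>M\<^esub> (a \<odot>\<^bsub>M\<^esub> x))\<rparr>"

text \<open>
  The left module presented by one generator \<open>z\<close> and the relations \<open>r \<cdot> z = 0\<close> for \<open>r \<in> S\<close>;
  the generator \<open>z\<close> is the coset of \<open>\<one>\<close>.
\<close>

definition presented_cyclic_module :: "('a, 'c) ring_scheme \<Rightarrow> 'a set \<Rightarrow> ('a, 'a set) module" where
  "presented_cyclic_module R S =
     quotient_module (regular_module R) (gen_submodule R (regular_module R) S)"


section \<open>Free associative algebras\<close>

datatype 'g fword = FWord (letters: "'g list")

instantiation fword :: (type) monoid_add
begin

definition zero_fword :: "'a fword" where
  "0 = FWord []"

definition plus_fword :: "'a fword \<Rightarrow> 'a fword \<Rightarrow> 'a fword" where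
  "v + w = FWord (letters v @ letters w)"

instance
  by standard (simp_all add: zero_fword_def plus_fword_def)

end

text \<open>
  With concatenation as addition of words, the convolution product on
  \<^typ>\<open>'g fword \<Rightarrow>\<^sub>0 'k\<close> is the product of the free associative unital algebra
  on \<^typ>\<open>'g\<close>. The embedding of the scalars is \<open>scal\<close>.
\<close>

type_synonym ('g, 'k) free_alg = "'g fword \<Rightarrow>\<^sub>0 'k"

definition gen :: "'g \<Rightarrow> ('g, 'k::ring_1) free_alg" where
  "gen a = Poly_Mapping.single (FWord [a]) 1"

definition scal :: "'k \<Rightarrow> ('g, 'k::ring_1) free_alg" where
  "scal c = Poly_Mapping.single 0 c"

abbreviation free_alg_ring :: "('g, 'k::ring_1) free_alg ring" where
  "free_alg_ring \<equiv> ring_of_type_algebra"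


section \<open>The double of the Jordan plane\<close>

datatype jgen = Gen_u | Gen_v | Gen_xi | Gen_g | Gen_ginv | Gen_x | Gen_y

text \<open>Each relation \<open>l = r\<close> is recorded as the element \<open>l - r\<close>.\<close>

definition double_rels :: "(jgen, 'k::field) free_alg set" where
  "double_rels =
    (let u = gen Gen_u; v = gen Gen_v; \<xi> = gen Gen_xi; g = gen Gen_g; g' = gen Gen_ginv;
         x = gen Gen_x; y = gen Gen_y;
         half = scal (1 / 2)
     in {g * g' - 1,
         g' * g - 1,
         \<xi> * g - g * \<xi>,
         g * x - x * g,
         g * y - (y * g + x * g),
         \<xi> * y - (y * \<xi> - 2 * y),
         \<xi> * x - (x * \<xi> - 2 * x),
         u * g - g * u,
         v * g - (g * v + g * u),
         v * \<xi> - (\<xi> * v - 2 * v),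
         u * \<xi> - (\<xi> * u - 2 * u),
         y * x - (x * y - half * x ^ 2),
         v * u - (u * v - half * u ^ 2),
         u * x - x * u,
         v * x - (x * v + (1 - g) + x * u),
         u * y - (y * u + (1 - g)),
         v * y - (y * v + half * g * \<xi> + y * u)})"

definition double_ideal :: "(jgen, 'k::field) free_alg set" where
  "double_ideal = genideal free_alg_ring double_rels"

definition jordan_double :: "(jgen, 'k::field) free_alg set ring" where
  "jordan_double = free_alg_ring Quot double_ideal"

definition dcls :: "(jgen, 'k::field) free_alg \<Rightarrow> (jgen, 'k) free_alg set" where
  "dcls f = double_ideal +>\<^bsub>free_alg_ring\<^esub> f"


section \<open>The modules \<open>T(n,m)\<close>\<close>

definition T_rels :: "nat \<Rightarrow> nat \<Rightarrow> (jgen, 'k::field) free_alg set" where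
  "T_rels n m =
     {gen Gen_g - 1, gen Gen_xi - of_nat (n + 2 * m), gen Gen_u, gen Gen_v, gen Gen_x ^ (m + 1)} \<union>
     {gen Gen_y ^ (n + 2 * (m - j) + 1) * gen Gen_x ^ j | j. j \<le> m}"

definition T_module ::
    "nat \<Rightarrow> nat \<Rightarrow> ((jgen, 'k::field) free_alg set, (jgen, 'k) free_alg set set) module" where
  "T_module n m = presented_cyclic_module jordan_double (dcls ` T_rels n m)"


section \<open>Well-definedness\<close>

lemma left_module_regular:
  assumes "ring R"
  shows "left_module R (regular_module R)"
proof -
  interpret ring R by fact
  have "abelian_group (regular_module R)"
    by (rule abelian_groupI)
       (use add.l_inv_ex in \<open>auto simp: regular_module_def a_ac\<close>)
  then show ?thesis
    by (intro left_module.intro assms left_module_axioms.intro)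
       (auto simp: regular_module_def l_distr r_distr m_assoc)
qed

lemma (in left_module) carrier_submodule: "submodule (carrier M) R M"
  using group.subgroup_self[OF M.a_group]
  by (intro submodule.intro submodule_axioms.intro smult_closed) simp_all

lemma (in left_module) gen_submodule_submodule:
  assumes "S \<subseteq> carrier M"
  shows "submodule (gen_submodule R M S) R M"
proof (intro submodule.intro submodule_axioms.intro)
  have ne: "{N. submodule N R M \<and> S \<subseteq> N} \<noteq> {}"
    using carrier_submodule assms by blast
  show "subgroup (gen_submodule R M S) (add_monoid M)"
    unfolding gen_submodule_def
    by (rule group.subgroups_Inter[OF a_group _ ne]) (auto dest: submodule.axioms(1))
  show "a \<odot>\<^bsub>M\<^esub> x \<in> gen_submodule R M S"
    if "a \<in> carrier R" "x \<in> gen_submodule R M S" for a x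
    using that by (auto simp: gen_submodule_def submodule.smult_closed)
qed

lemma (in left_module) smult_coset:
  assumes N: "submodule N R M" and a: "a \<in> carrier R" and x: "x \<in> carrier M"
  shows "a \<odot>\<^bsub>quotient_module M N\<^esub> (N +>\<^bsub>M\<^esub> x) = N +>\<^bsub>M\<^esub> (a \<odot>\<^bsub>M\<^esub> x)"
proof -
  interpret N: abelian_subgroup N M
    using submodule.axioms(1)[OF N]
    by (intro abelian_subgroupI3 additive_subgroup.intro) (auto simp: abelian_group_axioms)
  have "N +>\<^bsub>M\<^esub> (a \<odot>\<^bsub>M\<^esub> y) = N +>\<^bsub>M\<^esub> (a \<odot>\<^bsub>M\<^esub> x)" if "y \<in> N +>\<^bsub>M\<^esub> x" for y
  proof -
    from that obtain h where h: "h \<in> N" "y = h \<oplus>\<^bsub>M\<^esub> x"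
      by (auto simp: a_r_coset_def')
    have "a \<odot>\<^bsub>M\<^esub> y = a \<odot>\<^bsub>M\<^esub> h \<oplus>\<^bsub>M\<^esub> a \<odot>\<^bsub>M\<^esub> x"
      using h a x by (simp add: smult_r_distr)
    moreover have "a \<odot>\<^bsub>M\<^esub> h \<in> N"
      using N a h(1) by (rule submodule.smult_closed)
    ultimately have "a \<odot>\<^bsub>M\<^esub> y \<in> N +>\<^bsub>M\<^esub> (a \<odot>\<^bsub>M\<^esub> x)"
      by (auto simp: a_r_coset_def')
    then show ?thesis
      using N.a_repr_independence'[of _ "a \<odot>\<^bsub>M\<^esub> x"] a x smult_closed by blast
  qed
  moreover have "x \<in> N +>\<^bsub>M\<^esub> x"
    using N.a_rcos_self x by blast
  ultimately have "(\<Union>y\<in>N +>\<^bsub>M\<^esub> x. N +>\<^bsub>M\<^esub> (a \<odot>\<^bsub>M\<^esub> y)) = N +>\<^bsub>M\<^esub> (a \<odot>\<^bsub>M\<^esub> x)"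
    by blast
  then show ?thesis
    by (simp add: quotient_module_def)
qed

lemma (in left_module) quotient_left_module:
  assumes N: "submodule N R M"
  shows "left_module R (quotient_module M N)"
proof -
  interpret N: abelian_subgroup N M
    using submodule.axioms(1)[OF N]
    by (intro abelian_subgroupI3 additive_subgroup.intro) (auto simp: abelian_group_axioms)
  let ?Q = "quotient_module M N"
  have car: "carrier ?Q = (\<lambda>x. N +>\<^bsub>M\<^esub> x) ` carrier M"
    by (auto simp: quotient_module_def A_RCOSETS_def')
  have add: "(N +>\<^bsub>M\<^esub> x) \<oplus>\<^bsub>?Q\<^esub> (N +>\<^bsub>M\<^esub> y) = N +>\<^bsub>M\<^esub> (x \<oplus>\<^bsub>M\<^esub> y)"
    if "x \<in> carrier M" "y \<in> carrier M" for x y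
    using N.a_rcos_sum that by (simp add: quotient_module_def)
  have zero: "\<zero>\<^bsub>?Q\<^esub> = N +>\<^bsub>M\<^esub> \<zero>\<^bsub>M\<^esub>"
    using N.a_subset by (simp add: quotient_module_def)
  have inv: "\<exists>y\<in>carrier M. (N +>\<^bsub>M\<^esub> y) \<oplus>\<^bsub>?Q\<^esub> (N +>\<^bsub>M\<^esub> x) = N +>\<^bsub>M\<^esub> \<zero>\<^bsub>M\<^esub>"
    if "x \<in> carrier M" for x
    using that by (intro bexI[of _ "\<ominus>\<^bsub>M\<^esub> x"]) (simp_all add: add M.l_neg)
  have "abelian_group ?Q"
    by (rule abelian_groupI) (use inv in \<open>auto simp: car add zero M.a_ac\<close>)
  then show ?thesis
    by (intro left_module.intro left_module_axioms.intro)
       (auto simp: car add smult_coset[OF N] smult_closed smult_l_distr smult_r_distr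
          smult_assoc smult_one R.ring_axioms)
qed

lemma ring_free_alg: "ring (free_alg_ring :: ('g, 'k::ring_1) free_alg ring)"
proof -
  have "\<exists>y. x + y = 0 \<and> y + x = 0" for x :: "('g, 'k) free_alg"
    by (rule exI[of _ "- x"]) simp
  then show ?thesis
    unfolding ring_of_type_algebra_def
    by unfold_locales (auto simp: algebra_simps Units_def add_eq_0_iff)
qed

lemma ring_jordan_double: "ring jordan_double"
proof -
  interpret ring free_alg_ring
    by (rule ring_free_alg)
  have "ideal double_ideal free_alg_ring"
    unfolding double_ideal_def by (rule genideal_ideal) (simp add: ring_of_type_algebra_def)
  then show ?thesis
    unfolding jordan_double_def by (rule ideal.quotient_is_ring)
qed

lemma left_module_T_module: "left_module jordan_double (T_module n m)"
proof -
  interpret left_module jordan_double "regular_module jordan_double"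
    by (rule left_module_regular[OF ring_jordan_double])
  have "dcls f \<in> carrier (regular_module jordan_double)" for f
    by (auto simp: regular_module_def jordan_double_def FactRing_def dcls_def A_RCOSETS_def'
        ring_of_type_algebra_def)
  then show ?thesis
    unfolding T_module_def presented_cyclic_module_def
    by (intro quotient_left_module gen_submodule_submodule) auto
qed

end

theory Submission
  imports Defs
begin

text \<open>
  Write \<open>z\<close> for the generator of \<open>T(n,m)\<close>. The vectors \<open>y^i x^l z\<close> span the module, \<open>\<xi>\<close> multiplies
  such a vector by \<open>n + 2m - 2(i + l)\<close>, and \<open>x\<close>, \<open>g - 1\<close> and \<open>u\<close> raise the
  exponent \<open>l\<close>. Modulo higher powers of \<open>x\<close> only \<open>y\<close>, \<open>\<xi>\<close> and \<open>v\<close> are left, and they act as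
  a copy of \<open>sl\<^sub>2\<close>: the span of the \<open>y^i x^l z\<close> for one \<open>l\<close> is a highest weight module of highest weight
  \<open>n + 2(m - l)\<close>, generated by \<open>x^l z\<close>, and \<open>v^i\<close> returns \<open>y^i x^l z\<close> to a nonzero multiple of
  \<open>x^l z\<close> as long as \<open>i \<le> n + 2(m - l)\<close>; the larger \<open>i\<close> are killed by the relations.

  So let \<open>N\<close> be a submodule and \<open>J\<close> the least exponent with \<open>x^J z \<in> N\<close>. A vector of \<open>N\<close> splits into
  \<open>\<xi>\<close>-weight vectors that lie again in \<open>N\<close>. If a weight vector of \<open>N\<close> had a nonzero term
  \<open>y^i x^j z\<close> with \<open>j < J\<close>, then for the least such \<open>j\<close> the vector \<open>v^i\<close> applied to it would be a nonzero
  multiple of \<open>x^j z\<close> exactly, because the terms with higher powers of \<open>x\<close> end up in degree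
  \<open>i + l = j\<close> with \<open>l > j\<close>, where there is nothing. This contradicts the choice of \<open>J\<close>. Hence \<open>N\<close> is
  generated by \<open>x^J z\<close>, and such submodules form a chain.

  This argument works with a spanning set and would allow \<open>T(n,m)\<close> to be zero. What remains for
  indecomposability is to exclude that: \<open>T(n,m)\<close> maps onto the simple
  \<open>sl\<^sub>2\<close>-module of highest weight \<open>n + 2m\<close>, realized here inside the polynomials by differential operators.

  All computations take place in the free algebra, in left ideals that contain the defining
  relations; these are the preimages of the submodules of \<open>T(n,m)\<close>. The chain property is
  \<open>left_ideals_chain\<close>, its two main ingredients are \<open>weight_component\<close> and
  \<open>first_x_power_bounds_layer\<close>, and \<open>ex_proper_T_ideal\<close> gives that the module is nonzero.
\<close>

section \<open>Left ideals and the free algebra\<close>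

definition left_ideal :: "'a::ring_1 set \<Rightarrow> bool" where
  "left_ideal L \<longleftrightarrow> 0 \<in> L \<and> (\<forall>a\<in>L. \<forall>b\<in>L. a + b \<in> L) \<and> (\<forall>f. \<forall>a\<in>L. f * a \<in> L)"

lemma left_ideal_zero: "left_ideal L \<Longrightarrow> 0 \<in> L"
  and left_ideal_add: "left_ideal L \<Longrightarrow> a \<in> L \<Longrightarrow> b \<in> L \<Longrightarrow> a + b \<in> L"
  and left_ideal_mult: "left_ideal L \<Longrightarrow> a \<in> L \<Longrightarrow> f * a \<in> L"
  by (simp_all add: left_ideal_def)

lemma left_ideal_uminus: "left_ideal L \<Longrightarrow> a \<in> L \<Longrightarrow> - a \<in> L"
  using left_ideal_mult[of L a "-1"] by simp

lemma left_ideal_diff: "left_ideal L \<Longrightarrow> a \<in> L \<Longrightarrow> b \<in> L \<Longrightarrow> a - b \<in> L"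
  using left_ideal_add[of L a "- b"] left_ideal_uminus[of L b] by simp

lemma left_ideal_sum: "left_ideal L \<Longrightarrow> (\<And>i. i \<in> I \<Longrightarrow> f i \<in> L) \<Longrightarrow> sum f I \<in> L"
  by (induction I rule: infinite_finite_induct) (auto simp: left_ideal_zero left_ideal_add)

lemma free_alg_induct [case_names single add]:
  fixes f :: "('g, 'k::ring_1) free_alg"
  assumes single: "\<And>w c. P (Poly_Mapping.single w c)"
    and add: "\<And>f g. P f \<Longrightarrow> P g \<Longrightarrow> P (f + g)"
  shows "P f"
proof (induction f rule: update_induct)
  case const
  show ?case using single[of 0 0] by simp
next
  case (update f a b)
  have "Poly_Mapping.update a b f = f + Poly_Mapping.single a b"
    using update
    by (intro poly_mapping_eqI)
      (auto simp: lookup_update lookup_add lookup_single when_def in_keys_iff)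
  then show ?case using update single add by simp
qed

lemma single_Cons:
  "Poly_Mapping.single (FWord (a # w)) c = gen a * Poly_Mapping.single (FWord w) (c::'k::ring_1)"
  by (simp add: gen_def mult_single plus_fword_def)

lemma scal_central:
  fixes f :: "('g, 'k::comm_ring_1) free_alg"
  shows "scal c * f = f * scal c"
  by (induction f rule: free_alg_induct) (simp_all add: scal_def mult_single mult.commute algebra_simps)

lemma scal_0 [simp]: "scal 0 = 0"
  and scal_1 [simp]: "scal 1 = 1"
  and scal_add: "scal (a + b) = scal a + scal b"
  and scal_diff: "scal (a - b) = scal a - scal b"
  and scal_uminus: "scal (- a) = - scal a"
  and scal_mult: "scal (a * b) = scal a * scal b"
  and scal_numeral [simp]: "scal (numeral k) = numeral k"
  and scal_of_nat [simp]: "scal (of_nat i) = of_nat i"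
  by (simp_all add: scal_def single_add single_diff single_uminus mult_single)

lemma scal_left_commute:
  fixes f :: "('g, 'k::comm_ring_1) free_alg"
  shows "f * (scal c * h) = scal c * (f * h)"
  by (metis scal_central mult.assoc)

lemmas gen_scal_commute = scal_left_commute[of "gen a" for a]

lemma left_ideal_scal_cancel:
  fixes c :: "'k::field"
  assumes "left_ideal N" "scal c * f \<in> N" "c \<noteq> 0"
  shows "f \<in> N"
proof -
  have "scal (inverse c) * (scal c * f) = f"
    using assms(3) by (simp flip: mult.assoc scal_mult)
  with left_ideal_mult[OF assms(1,2), of "scal (inverse c)"] show ?thesis by simp
qed

abbreviation "gu \<equiv> gen Gen_u"
abbreviation "gv \<equiv> gen Gen_v"
abbreviation "gx \<equiv> gen Gen_x"
abbreviation "gy \<equiv> gen Gen_y"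
abbreviation "gg \<equiv> gen Gen_g"
abbreviation "ginv \<equiv> gen Gen_ginv"
abbreviation "gxi \<equiv> gen Gen_xi"

section \<open>Left ideals containing the relations of \<open>T(n,m)\<close>\<close>

lemma double_ideal_ideal: "ideal (double_ideal :: (jgen, 'k::field) free_alg set) free_alg_ring"
proof -
  interpret ring free_alg_ring
    by (rule ring_free_alg)
  show ?thesis
    unfolding double_ideal_def by (rule genideal_ideal) (simp add: ring_of_type_algebra_def)
qed

lemma double_rels_subset: "double_rels \<subseteq> double_ideal"
proof -
  interpret ring free_alg_ring
    by (rule ring_free_alg)
  show ?thesis
    unfolding double_ideal_def by (rule genideal_self) (simp add: ring_of_type_algebra_def)
qed

lemma double_ideal_mult_right: "r \<in> double_ideal \<Longrightarrow> r * f \<in> double_ideal"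
  using ideal.I_r_closed[OF double_ideal_ideal, of r f] by (simp add: ring_of_type_algebra_def)

text \<open>
  \<open>K\<close> is the preimage in the free algebra of an arbitrary submodule of \<open>T(n,m)\<close>. Computing
  modulo \<open>K\<close> is computing in a quotient of \<open>T(n,m)\<close>, with \<open>f\<close> standing for \<open>f \<cdot> z\<close>.
\<close>
locale T_ideal =
  fixes K :: "(jgen, 'k::field_char_0) free_alg set" and n m :: nat
  assumes left_ideal: "left_ideal K"
    and double_ideal_subset: "double_ideal \<subseteq> K"
    and T_rels_subset: "T_rels n m \<subseteq> K"
begin

lemmas K_zero = left_ideal_zero[OF left_ideal]
  and K_add = left_ideal_add[OF left_ideal]
  and K_diff = left_ideal_diff[OF left_ideal]
  and K_mult = left_ideal_mult[OF left_ideal]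

text \<open>
  The relations of the algebra may be multiplied on both sides, since they generate a two-sided
  ideal, whereas those of the module act only on \<open>z\<close>. So the former hold in front of any element
  \<open>f\<close>, the latter only without a factor on the right.
\<close>

lemma rel_mult: "r \<in> double_rels \<Longrightarrow> r * f \<in> K"
  using double_rels_subset double_ideal_mult_right double_ideal_subset by blast

lemma
  shows rel_ginv: "ginv * (gg * f) - f \<in> K"
    and rel_gx: "gg * (gx * f) - gx * (gg * f) \<in> K"
    and rel_gy: "gg * (gy * f) - (gy * (gg * f) + gx * (gg * f)) \<in> K"
    and rel_xiy: "gxi * (gy * f) - (gy * (gxi * f) - 2 * (gy * f)) \<in> K"
    and rel_xix: "gxi * (gx * f) - (gx * (gxi * f) - 2 * (gx * f)) \<in> K"
    and rel_ux: "gu * (gx * f) - gx * (gu * f) \<in> K"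
    and rel_uy: "gu * (gy * f) - (gy * (gu * f) + (f - gg * f)) \<in> K"
    and rel_vx: "gv * (gx * f) - (gx * (gv * f) + (f - gg * f) + gx * (gu * f)) \<in> K"
    and rel_vy: "gv * (gy * f) -
      (gy * (gv * f) + scal (1 / 2) * (gg * (gxi * f)) + gy * (gu * f)) \<in> K"
  using rel_mult[of "ginv * gg - 1" f] rel_mult[of "gg * gx - gx * gg" f]
    rel_mult[of "gg * gy - (gy * gg + gx * gg)" f]
    rel_mult[of "gxi * gy - (gy * gxi - 2 * gy)" f]
    rel_mult[of "gxi * gx - (gx * gxi - 2 * gx)" f]
    rel_mult[of "gu * gx - gx * gu" f]
    rel_mult[of "gu * gy - (gy * gu + (1 - gg))" f]
    rel_mult[of "gv * gx - (gx * gv + (1 - gg) + gx * gu)" f]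
    rel_mult[of "gv * gy - (gy * gv + scal (1 / 2) * gg * gxi + gy * gu)" f]
  by (simp_all add: double_rels_def Let_def left_diff_distrib distrib_right mult.assoc)

text \<open>
  The relation for \<open>y x\<close> is solved for \<open>x y\<close> because the monomials below carry \<open>y\<close> on the left.
\<close>

lemma rel_xy: "gx * (gy * f) - (gy * (gx * f) + scal (1 / 2) * (gx * (gx * f))) \<in> K"
proof -
  have "(gy * gx - (gx * gy - scal (1 / 2) * gx ^ 2)) * f \<in> K"
    by (rule rel_mult) (simp add: double_rels_def Let_def)
  from left_ideal_uminus[OF left_ideal this] show ?thesis
    by (simp add: left_diff_distrib distrib_right mult.assoc power2_eq_square algebra_simps)
qed

lemma
  shows rel_g: "gg - 1 \<in> K" and rel_xi: "gxi - of_nat (n + 2 * m) \<in> K"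
    and rel_u: "gu \<in> K" and rel_v: "gv \<in> K" and rel_x: "gx ^ Suc m \<in> K"
    and rel_yx: "j \<le> m \<Longrightarrow> gy ^ (n + 2 * (m - j) + 1) * gx ^ j \<in> K"
  using T_rels_subset by (auto simp: T_rels_def)

section \<open>Layers of monomials\<close>

definition pbw :: "nat \<Rightarrow> nat \<Rightarrow> (jgen, 'k) free_alg" where
  "pbw i l = gy ^ i * gx ^ l"

lemma pbw_0: "pbw 0 l = gx ^ l" and pbw_Suc: "pbw (Suc i) l = gy * pbw i l"
  and x_pbw_0: "gx * pbw 0 l = pbw 0 (Suc l)"
  by (simp_all add: pbw_def mult.assoc)

text \<open>
  Modulo \<open>K\<close> this is the span of the monomials \<open>y^i x^l\<close> of degree \<open>i + l = d\<close> with \<open>l \<ge> j\<close>: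
  the degree \<open>d\<close> part of the submodule generated by \<open>x^j z\<close>. It contains \<open>K\<close>, so that
  congruences modulo \<open>K\<close> become memberships.
\<close>

inductive_set layer :: "nat \<Rightarrow> nat \<Rightarrow> (jgen, 'k) free_alg set" for j d :: nat where
  K: "a \<in> K \<Longrightarrow> a \<in> layer j d"
| add_pbw: "b \<in> layer j d \<Longrightarrow> j \<le> l \<Longrightarrow> i + l = d \<Longrightarrow> b + scal c * pbw i l \<in> layer j d"

lemma layer_add: "a \<in> layer j d \<Longrightarrow> b \<in> layer j d \<Longrightarrow> a + b \<in> layer j d"
proof (induction a rule: layer.induct)
  case (K a)
  from this(2,1) show ?case
  proof (induction b rule: layer.induct)
    case (add_pbw b l i c)
    from layer.add_pbw[OF add_pbw(4)[OF add_pbw(5)] add_pbw(2,3), of c] show ?case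
      by (simp add: algebra_simps)
  qed (auto intro: layer.K K_add)
next
  case (add_pbw a l i c)
  from layer.add_pbw[OF add_pbw(4)[OF add_pbw(5)] add_pbw(2,3), of c] show ?case
    by (simp add: algebra_simps)
qed

lemma layer_pbw: "j \<le> l \<Longrightarrow> i + l = d \<Longrightarrow> pbw i l \<in> layer j d"
  using layer.add_pbw[OF layer.K[OF K_zero], of j l i d 1] by simp

lemma layer_subset: "b \<in> layer j d \<Longrightarrow> j' \<le> j \<Longrightarrow> b \<in> layer j' d"
  by (induction rule: layer.induct) (auto intro: layer.intros)

lemma layer_scal: "b \<in> layer j d \<Longrightarrow> scal c * b \<in> layer j d"
proof (induction rule: layer.induct)
  case (add_pbw b l i c')
  from layer.add_pbw[OF add_pbw(4,2,3), of "c * c'"] show ?case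
    by (simp add: distrib_left scal_mult mult.assoc)
qed (auto intro: layer.K K_mult)

lemma layer_uminus: "b \<in> layer j d \<Longrightarrow> - b \<in> layer j d"
  using layer_scal[of b j d "-1"] by (simp add: scal_uminus)

lemma layer_diff: "a \<in> layer j d \<Longrightarrow> b \<in> layer j d \<Longrightarrow> a - b \<in> layer j d"
  using layer_add[of a j d "- b"] layer_uminus[of b] by simp

lemma layer_cong: "a - b \<in> K \<Longrightarrow> a \<in> layer j d \<longleftrightarrow> b \<in> layer j d"
  using layer_add[of b j d "a - b"] layer_diff[of a j d "a - b"] layer.K[of "a - b" j d]
  by auto

text \<open>
  Since scalars are central, the effect of left multiplication on a layer can be checked on
  monomials. The computations for the single generators are therefore done on monomials only.
\<close>

lemma layer_mult:
  assumes b: "b \<in> layer j d"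
    and f: "\<And>i l. j \<le> l \<Longrightarrow> i + l = d \<Longrightarrow> f * pbw i l \<in> layer j' d'"
  shows "f * b \<in> layer j' d'"
  using b
proof (induction rule: layer.induct)
  case (add_pbw b l i c)
  then show ?case
    using layer_add[OF add_pbw(4) layer_scal[OF f[OF add_pbw(2,3)], of c]]
    by (simp add: distrib_left scal_left_commute[of f])
qed (auto intro: layer.K K_mult)

text \<open>
  No monomial has \<open>j \<le> l \<le> d < j\<close>. This is what turns statements modulo higher powers of \<open>x\<close> into
  exact ones at the bottom degree.
\<close>

lemma layer_above_degree: "d < j \<Longrightarrow> layer j d = K"
proof -
  have "b \<in> K" if "b \<in> layer j d" "d < j" for b
    using that by (induction rule: layer.induct) auto
  then show "layer j d = K" if "d < j" using that by (auto intro: layer.K)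
qed

text \<open>
  Degree \<open>d\<close> contains only one monomial with exactly \<open>j\<close> factors \<open>x\<close>, so two consecutive layers
  differ by at most one dimension.
\<close>

lemma layer_top:
  assumes "b \<in> layer j d"
  shows "\<exists>c. \<exists>b'\<in>layer (Suc j) d. b = b' + scal c * pbw (d - j) j"
  using assms
proof (induction rule: layer.induct)
  case (K a)
  then show ?case by (intro exI[of _ 0] bexI[of _ a]) (auto intro: layer.K)
next
  case (add_pbw b l i c)
  then obtain c' b' where b': "b' \<in> layer (Suc j) d" "b = b' + scal c' * pbw (d - j) j" by blast
  show ?case
  proof (cases "l = j")
    case True
    with add_pbw b' show ?thesis
      by (intro exI[of _ "c' + c"] bexI[of _ b']) (auto simp: scal_add algebra_simps)
  next
    case False
    with add_pbw b' show ?thesis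
      by (intro exI[of _ c'] bexI[of _ "b' + scal c * pbw i l"])
        (auto simp: algebra_simps intro: layer.add_pbw)
  qed
qed

section \<open>Action of the generators on the layers\<close>

lemma y_layer: "b \<in> layer j d \<Longrightarrow> gy * b \<in> layer j (Suc d)"
  by (rule layer_mult) (auto simp: pbw_Suc[symmetric] intro: layer_pbw)

text \<open>
  Moving \<open>x\<close> past a \<open>y\<close> by \<open>x y = y x + x\<^sup>2/2\<close> produces a second term with one \<open>y\<close> less and two
  factors \<open>x\<close> in front. The induction must therefore cover all monomials with fewer factors \<open>y\<close>,
  since the inner \<open>x\<close> has already spread its argument over a whole layer.
\<close>

lemma x_pbw: "gx * pbw i l \<in> layer (Suc l) (Suc (i + l))"
proof (induction i arbitrary: l rule: less_induct)
  case (less i)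
  show ?case
  proof (cases i)
    case 0
    then show ?thesis by (simp add: x_pbw_0 layer_pbw)
  next
    case (Suc i')
    have 1: "gx * pbw i' l \<in> layer (Suc l) (Suc (i' + l))"
      using less Suc by simp
    \<comment> \<open>a monomial with at least \<open>l + 1\<close> factors \<open>x\<close> in the degree of \<open>x y^{i'} x^l\<close> has at most \<open>i'\<close> factors \<open>y\<close>\<close>
    have "gx * (gx * pbw i' l) \<in> layer (Suc l) (Suc (Suc (i' + l)))"
    proof (rule layer_mult[OF 1])
      fix i'' l' assume *: "Suc l \<le> l'" "i'' + l' = Suc (i' + l)"
      then have "gx * pbw i'' l' \<in> layer (Suc l') (Suc (i'' + l'))"
        using Suc by (intro less) auto
      with * show "gx * pbw i'' l' \<in> layer (Suc l) (Suc (Suc (i' + l)))"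
        by (auto intro: layer_subset)
    qed
    then have "gy * (gx * pbw i' l) + scal (1 / 2) * (gx * (gx * pbw i' l))
        \<in> layer (Suc l) (Suc (i + l))"
      using y_layer[OF 1] Suc by (intro layer_add layer_scal) auto
    then show ?thesis
      using layer_cong[OF rel_xy] by (simp add: Suc pbw_Suc)
  qed
qed

lemma x_layer: "b \<in> layer j d \<Longrightarrow> gx * b \<in> layer (Suc j) (Suc d)"
  by (erule layer_mult) (use x_pbw in \<open>blast intro: layer_subset Suc_le_mono[THEN iffD2]\<close>)

text \<open>
  \<open>g\<close> fixes \<open>x^l z\<close>, and \<open>g y = (y + x) g\<close>: each passage of \<open>g\<close> past a \<open>y\<close> costs terms with an additional \<open>x\<close>.
\<close>

lemma g_pbw: "gg * pbw i l - pbw i l \<in> layer (Suc l) (i + l)"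
proof (induction i)
  case 0
  have "gg * gx ^ l - gx ^ l \<in> K"
  proof (induction l)
    case (Suc l)
    have "(gg * (gx * gx ^ l) - gx * (gg * gx ^ l)) + gx * (gg * gx ^ l - gx ^ l) \<in> K"
      by (intro K_add K_mult rel_gx Suc)
    then show ?case by (simp add: algebra_simps)
  qed (use rel_g in simp)
  then show ?case by (simp add: pbw_0 layer.K)
next
  case (Suc i)
  let ?b = "pbw i l"
  have "(gg * (gy * ?b) - (gy * (gg * ?b) + gx * (gg * ?b))) +
      (gy * (gg * ?b - ?b) + (gx * (gg * ?b - ?b) + gx * ?b)) \<in> layer (Suc l) (Suc (i + l))"
    by (intro layer_add layer.K rel_gy y_layer Suc x_pbw layer_subset[OF x_layer[OF Suc]]) simp
  then show ?case by (simp add: pbw_Suc algebra_simps)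
qed

lemma g_layer: "b \<in> layer j d \<Longrightarrow> gg * b - b \<in> layer (Suc j) d"
  using layer_mult[of b j d "gg - 1" "Suc j" d] g_pbw
  by (auto simp: left_diff_distrib intro: layer_subset)

text \<open>
  On a fixed degree \<open>g - 1\<close> is nilpotent, as it raises \<open>j\<close> and \<open>j\<close> is bounded by \<open>d\<close>. Hence the
  inverse of \<open>g\<close> preserves the layers, by downward induction on \<open>j\<close> along
  \<open>g^{-1} b = b - g^{-1} (g - 1) b\<close>.
\<close>

lemma ginv_layer: "b \<in> layer j d \<Longrightarrow> ginv * b \<in> layer j d"
proof (induction "Suc d - j" arbitrary: j b)
  case 0
  then show ?case using layer_above_degree[of d j] by (simp add: K_mult)
next
  case (Suc r)
  have "ginv * (gg * b - b) \<in> layer (Suc j) d"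
    using Suc by (intro Suc(1) g_layer) auto
  then have "ginv * (gg * b - b) \<in> layer j d"
    by (rule layer_subset) simp
  then have "b + (ginv * (gg * b) - b) - ginv * (gg * b - b) \<in> layer j d"
    by (intro layer_add layer_diff layer.K[OF rel_ginv] Suc(3))
  then show ?case by (simp add: algebra_simps)
qed

lemma u_pbw_0: "gu * pbw 0 l \<in> K"
proof (induction l)
  case (Suc l)
  from K_add[OF rel_ux[of "pbw 0 l"] K_mult[OF Suc, of gx]] show ?case
    by (simp add: pbw_0)
qed (use rel_u in \<open>simp add: pbw_0\<close>)

text \<open>
  \<open>u\<close> commutes with \<open>y\<close> up to \<open>1 - g\<close>, so it inherits from \<open>g - 1\<close> that it raises the exponent of \<open>x\<close>.
\<close>

lemma u_pbw: "gu * pbw (Suc i) l \<in> layer (Suc l) (i + l)"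
proof (induction i)
  case 0
  have "gy * (gu * pbw 0 l) - (gg * pbw 0 l - pbw 0 l) \<in> layer (Suc l) l"
    using g_pbw[of 0 l] by (intro layer_diff[OF layer.K[OF K_mult[OF u_pbw_0]]]) auto
  then show ?case
    using layer_cong[OF rel_uy[of "pbw 0 l"]] by (simp add: pbw_Suc algebra_simps)
next
  case (Suc i)
  have "gy * (gu * pbw (Suc i) l) - (gg * pbw (Suc i) l - pbw (Suc i) l)
      \<in> layer (Suc l) (Suc i + l)"
    by (rule layer_diff) (use y_layer[OF Suc] g_pbw[of "Suc i" l] in simp_all)
  then show ?case
    using layer_cong[OF rel_uy[of "pbw (Suc i) l"]] by (simp add: pbw_Suc algebra_simps)
qed

definition weight :: "nat \<Rightarrow> 'k" where
  "weight d = of_nat (n + 2 * m) - 2 * of_nat d"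

lemma scal_weight_Suc: "scal (weight (Suc d)) = (scal (weight d) - 2 :: (jgen, 'k) free_alg)"
  by (simp add: weight_def scal_diff scal_add scal_mult algebra_simps)

lemma xi_pbw: "gxi * pbw i l - scal (weight (i + l)) * pbw i l \<in> K"
proof (induction i)
  case 0
  have "gxi * gx ^ l - scal (weight l) * gx ^ l \<in> K"
  proof (induction l)
    case 0
    then show ?case using rel_xi by (simp add: weight_def scal_diff scal_add scal_mult)
  next
    case (Suc l)
    have "(gxi * (gx * gx ^ l) - (gx * (gxi * gx ^ l) - 2 * (gx * gx ^ l))) +
        gx * (gxi * gx ^ l - scal (weight l) * gx ^ l) \<in> K"
      by (intro K_add K_mult rel_xix Suc)
    then show ?case by (simp add: scal_weight_Suc algebra_simps gen_scal_commute)
  qed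
  then show ?case by (simp add: pbw_0)
next
  case (Suc i)
  let ?b = "pbw i l"
  have "(gxi * (gy * ?b) - (gy * (gxi * ?b) - 2 * (gy * ?b))) +
      gy * (gxi * ?b - scal (weight (i + l)) * ?b) \<in> K"
    by (intro K_add K_mult rel_xiy Suc)
  then show ?case by (simp add: scal_weight_Suc algebra_simps gen_scal_commute pbw_Suc)
qed

lemma xi_layer: "b \<in> layer j d \<Longrightarrow> gxi * b - scal (weight d) * b \<in> K"
proof (induction rule: layer.induct)
  case (K a)
  then show ?case by (intro K_diff K_mult)
next
  case (add_pbw b l i c)
  then have "gxi * b - scal (weight d) * b +
      scal c * (gxi * pbw i l - scal (weight (i + l)) * pbw i l) \<in> K"
    by (intro K_add K_mult xi_pbw)
  with add_pbw(3) show ?case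
    by (simp add: algebra_simps gen_scal_commute scal_left_commute[of "scal (weight d)" c "pbw i l"])
qed

text \<open>
  For a highest weight \<open>k = n + 2m - 2l\<close> this is \<open>(i + 1) (k - i) / 2\<close>, the factor by which \<open>sl\<^sub>2\<close>-raising
  takes the vector number \<open>i + 1\<close> of the string through \<open>x^l z\<close> to the vector number \<open>i\<close>. The
  denominator comes from \<open>v y - y v\<close> being \<open>\<xi>/2\<close> where \<open>g\<close> acts as \<open>1\<close> and \<open>u\<close> as \<open>0\<close>.
\<close>

definition v_coeff :: "nat \<Rightarrow> nat \<Rightarrow> 'k" where
  "v_coeff i l = of_nat (Suc i) * (of_nat (n + 2 * m) - 2 * of_nat l - of_nat i) / 2"

lemma v_pbw_0: "gv * pbw 0 l \<in> K"
proof (induction l)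
  case (Suc l)
  let ?b = "pbw 0 l"
  have g: "gg * ?b - ?b \<in> K"
    using g_pbw[of 0 l] by (simp add: layer_above_degree)
  from K_add[OF rel_vx[of ?b]
      K_add[OF K_diff[OF K_mult[OF Suc, of gx] g] K_mult[OF u_pbw_0, of gx l]]]
  show ?case by (simp add: x_pbw_0 algebra_simps)
qed (use rel_v in \<open>simp add: pbw_0\<close>)

text \<open>
  The term \<open>g \<xi>/2\<close> in the commutator of \<open>v\<close> and \<open>y\<close> acts, up to higher powers of \<open>x\<close>, as half the weight.
\<close>

lemma g_xi_pbw:
  "scal (1 / 2) * (gg * (gxi * pbw i l)) - scal (weight (i + l) / 2) * pbw i l \<in> layer (Suc l) (i + l)"
proof -
  let ?b = "pbw i l" and ?w = "weight (i + l)"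
  have "scal (1 / 2) * (gg * (gxi * ?b - scal ?w * ?b)) +
      scal (1 / 2) * (scal ?w * (gg * ?b - ?b)) \<in> layer (Suc l) (i + l)"
    by (intro layer_add layer.K K_mult xi_pbw layer_scal g_pbw)
  moreover have "scal (?w / 2) = scal (1 / 2) * (scal ?w :: (jgen, 'k) free_alg)"
    by (simp flip: scal_mult)
  ultimately show ?thesis by (simp add: algebra_simps gen_scal_commute mult.assoc)
qed

text \<open>
  The \<open>sl\<^sub>2\<close> computation: commuting \<open>v\<close> past the factors \<open>y\<close> one at a time collects half of each weight
  met on the way, and the contributions of \<open>u\<close> and \<open>g - 1\<close> go to higher powers of \<open>x\<close>.
\<close>

lemma v_pbw: "gv * pbw (Suc i) l - scal (v_coeff i l) * pbw i l \<in> layer (Suc l) (i + l)"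
proof (induction i)
  case 0
  let ?b = "pbw 0 l"
  have "(gv * (gy * ?b) - (gy * (gv * ?b) + scal (1 / 2) * (gg * (gxi * ?b)) + gy * (gu * ?b))) +
    (gy * (gv * ?b) +
     (scal (1 / 2) * (gg * (gxi * ?b)) - scal (weight (0 + l) / 2) * ?b) + gy * (gu * ?b))
     \<in> layer (Suc l) (0 + l)"
    by (intro layer_add g_xi_pbw layer.K[OF rel_vy] layer.K[OF K_mult[OF v_pbw_0]]
        layer.K[OF K_mult[OF u_pbw_0]])
  moreover have "weight (0 + l) / 2 = v_coeff 0 l"
    by (simp add: weight_def v_coeff_def)
  ultimately show ?case by (simp add: pbw_Suc algebra_simps)
next
  case (Suc i)
  let ?b = "pbw (Suc i) l"
  have "(gv * (gy * ?b) - (gy * (gv * ?b) + scal (1 / 2) * (gg * (gxi * ?b)) + gy * (gu * ?b))) +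
    (gy * (gv * ?b - scal (v_coeff i l) * pbw i l) +
     (scal (1 / 2) * (gg * (gxi * ?b)) - scal (weight (Suc i + l) / 2) * ?b) + gy * (gu * ?b))
     \<in> layer (Suc l) (Suc i + l)"
    using y_layer[OF Suc] y_layer[OF u_pbw[of i l]]
    by (intro layer_add g_xi_pbw layer.K[OF rel_vy]) simp_all
  moreover have "v_coeff (Suc i) l = v_coeff i l + weight (Suc i + l) / 2"
    by (simp add: weight_def v_coeff_def field_simps)
  ultimately show ?case by (simp add: pbw_Suc algebra_simps scal_add gen_scal_commute)
qed

lemma u_layer: "b \<in> layer j (Suc d) \<Longrightarrow> gu * b \<in> layer j d"
proof (erule layer_mult)
  fix i l assume "j \<le> l" "i + l = Suc d"
  then show "gu * pbw i l \<in> layer j d"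
    by (cases i) (auto intro: layer.K u_pbw_0 layer_subset[OF u_pbw])
qed

lemma v_layer: "b \<in> layer j (Suc d) \<Longrightarrow> gv * b \<in> layer j d"
proof (erule layer_mult)
  fix i l assume *: "j \<le> l" "i + l = Suc d"
  show "gv * pbw i l \<in> layer j d"
  proof (cases i)
    case 0
    then show ?thesis by (simp add: layer.K v_pbw_0)
  next
    case (Suc i')
    have "(gv * pbw i l - scal (v_coeff i' l) * pbw i' l) + scal (v_coeff i' l) * pbw i' l \<in> layer j d"
      using v_pbw[of i' l] * Suc
      by (intro layer_add layer_scal layer_pbw) (auto elim: layer_subset)
    then show ?thesis by simp
  qed
qed

lemma v_power_layer: "b \<in> layer j (i + d) \<Longrightarrow> gv ^ i * b \<in> layer j d"
proof (induction i arbitrary: b)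
  case (Suc i)
  from Suc(1)[OF v_layer, of b] Suc(2) show ?case
    by (simp add: power_Suc2 mult.assoc del: power_Suc)
qed simp

lemma u_layer_0: "b \<in> layer j 0 \<Longrightarrow> gu * b \<in> K" and v_layer_0: "b \<in> layer j 0 \<Longrightarrow> gv * b \<in> K"
  using layer_mult[of b j 0 gu 1 0] layer_mult[of b j 0 gv 1 0]
  by (simp_all add: layer_above_degree u_pbw_0 v_pbw_0)

text \<open>
  Here characteristic zero enters: in positive characteristic the coefficient may vanish inside the string.
\<close>

lemma v_coeff_nonzero:
  assumes "i + 2 * l < n + 2 * m"
  shows "v_coeff i l \<noteq> 0"
proof -
  have "of_nat (n + 2 * m) - 2 * of_nat l - of_nat i = (of_nat (n + 2 * m - (2 * l + i)) :: 'k)"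
    using assms by (subst of_nat_diff) (auto simp: algebra_simps)
  also have "\<dots> \<noteq> 0"
    unfolding of_nat_eq_0_iff using assms by simp
  finally show ?thesis
    by (simp add: v_coeff_def del: of_nat_Suc)
qed

text \<open>
  The congruence holds modulo \<open>K\<close> and not only modulo a higher layer: each error term produced by \<open>v_pbw\<close>
  has at least \<open>l + 1\<close> factors \<open>x\<close>, and the remaining powers of \<open>v\<close> lower it to degree \<open>l\<close>, where its
  layer is \<open>K\<close>.
\<close>

lemma v_power_pbw:
  assumes "i + 2 * l \<le> n + 2 * m"
  shows "\<exists>c. c \<noteq> 0 \<and> gv ^ i * pbw i l - scal c * gx ^ l \<in> K"
  using assms
proof (induction i)
  case 0
  show ?case by (rule exI[of _ 1]) (simp add: pbw_0 K_zero)
next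
  case (Suc i)
  then obtain c where c: "c \<noteq> 0" "gv ^ i * pbw i l - scal c * gx ^ l \<in> K" by auto
  let ?b = "gv * pbw (Suc i) l - scal (v_coeff i l) * pbw i l"
  have "gv ^ i * ?b \<in> K"
    using v_power_layer[OF v_pbw] layer_above_degree by auto
  from K_add[OF this K_mult[OF c(2), of "scal (v_coeff i l)"]]
  have "gv ^ Suc i * pbw (Suc i) l - scal (v_coeff i l * c) * gx ^ l \<in> K"
    by (simp add: power_Suc2 mult.assoc scal_mult algebra_simps scal_left_commute[of "gv ^ i"]
        scal_left_commute[of "scal (v_coeff i l)" c] del: power_Suc)
  then show ?case using v_coeff_nonzero[of i l] Suc c by (intro exI[of _ "v_coeff i l * c"]) auto
qed

section \<open>Decomposition into weight vectors\<close>

definition graded_sums :: "(jgen, 'k) free_alg set" where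
  "graded_sums = {\<Sum>d<D. b d | b D. \<forall>d. b d \<in> layer 0 d}"

lemma graded_sumsI: "(\<And>d. b d \<in> layer 0 d) \<Longrightarrow> (\<Sum>d<D. b d) \<in> graded_sums"
  unfolding graded_sums_def by blast

lemma graded_sums_add:
  assumes "a \<in> graded_sums" "b \<in> graded_sums"
  shows "a + b \<in> graded_sums"
proof -
  from assms obtain D E f h where f: "\<And>d. f d \<in> layer 0 d" "a = (\<Sum>d<D. f d)"
    and h: "\<And>d. h d \<in> layer 0 d" "b = (\<Sum>d<E. h d)"
    unfolding graded_sums_def by blast
  let ?f = "\<lambda>d. if d < D then f d else 0" and ?h = "\<lambda>d. if d < E then h d else 0"
  have "(\<Sum>d<max D E. ?f d) = a"
    unfolding f(2) by (rule sum.mono_neutral_cong_right) auto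
  moreover have "(\<Sum>d<max D E. ?h d) = b"
    unfolding h(2) by (rule sum.mono_neutral_cong_right) auto
  moreover have "(\<Sum>d<max D E. ?f d + ?h d) \<in> graded_sums"
    by (rule graded_sumsI, rule layer_add) (simp_all add: f(1) h(1) layer.K K_zero)
  ultimately show ?thesis
    by (simp add: sum.distrib)
qed

lemma layer_graded_sums:
  assumes "b \<in> layer j d"
  shows "b \<in> graded_sums"
proof -
  have "(\<Sum>e<Suc d. if e = d then b else 0) \<in> graded_sums"
    using assms by (intro graded_sumsI) (auto intro: layer_subset layer.K K_zero)
  then show ?thesis by simp
qed

lemma graded_sums_mult:
  assumes "w \<in> graded_sums" and f: "\<And>d b. b \<in> layer 0 d \<Longrightarrow> f * b \<in> graded_sums"
  shows "f * w \<in> graded_sums"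
proof -
  from assms(1) obtain b D where b: "\<forall>d. b d \<in> layer 0 d" "w = (\<Sum>d<D. b d)"
    unfolding graded_sums_def by blast
  have "(\<Sum>d<D. f * b d) \<in> graded_sums" for D
    by (induction D)
      (auto intro: layer_graded_sums layer.K K_zero graded_sums_add f b(1)[rule_format])
  then show ?thesis by (simp add: b sum_distrib_left)
qed

text \<open>
  Every generator maps a degree into a degree, up to \<open>K\<close>. The degree \<open>0\<close> is separate for \<open>u\<close> and \<open>v\<close>, which
  would lower it and therefore vanish there.
\<close>

lemma graded_sums_gen:
  assumes "w \<in> graded_sums"
  shows "gen a * w \<in> graded_sums"
  using assms
proof (rule graded_sums_mult)
  fix d b
  assume b: "b \<in> layer 0 d"
  show "gen a * b \<in> graded_sums"
  proof (cases a)
    case Gen_u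
    with b show ?thesis
      by (cases d) (auto intro: layer_graded_sums u_layer layer.K[OF u_layer_0])
  next
    case Gen_v
    with b show ?thesis
      by (cases d) (auto intro: layer_graded_sums v_layer layer.K[OF v_layer_0])
  next
    case Gen_xi
    have "(gxi * b - scal (weight d) * b) + scal (weight d) * b \<in> layer 0 d"
      by (intro layer_add layer.K[OF xi_layer[OF b]] layer_scal b)
    then show ?thesis using Gen_xi layer_graded_sums by simp
  next
    case Gen_g
    have "(gg * b - b) + b \<in> layer 0 d"
      by (intro layer_add layer_subset[OF g_layer[OF b]] b) simp
    then show ?thesis using Gen_g layer_graded_sums by simp
  next
    case Gen_ginv
    with b show ?thesis by (auto intro: layer_graded_sums ginv_layer)
  next
    case Gen_x
    with b show ?thesis by (auto intro: layer_graded_sums x_layer)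
  next
    case Gen_y
    with b show ?thesis by (auto intro: layer_graded_sums y_layer)
  qed
qed

lemma graded_sums_UNIV: "w \<in> graded_sums"
proof (induction w rule: free_alg_induct)
  case (single w c)
  have "Poly_Mapping.single (FWord ws) c \<in> graded_sums" for ws
  proof (induction ws)
    case Nil
    have "scal c * pbw 0 0 \<in> layer 0 0"
      by (intro layer_scal layer_pbw) auto
    then show ?case
      using layer_graded_sums by (simp add: pbw_def scal_def zero_fword_def)
  next
    case (Cons a ws)
    then show ?case by (simp add: single_Cons graded_sums_gen)
  qed
  then show ?case by (cases w) simp
qed (rule graded_sums_add)

text \<open>
  Eigenvectors for distinct eigenvalues of \<open>\<xi>\<close>: applying \<open>\<xi> - weight D\<close> removes the top component
  and multiplies the others by nonzero scalars, so induction on the number of components applies.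
\<close>

lemma weight_component:
  assumes N: "left_ideal N" "K \<subseteq> N"
    and b: "\<forall>d. b d \<in> layer 0 d" "(\<Sum>d<D. b d) \<in> N" "d < D"
  shows "b d \<in> N"
  using b
proof (induction D arbitrary: b d)
  case (Suc D)
  let ?w = "\<Sum>e<Suc D. b e"
  \<comment> \<open>the components of \<open>(\<xi> - weight D) w\<close>\<close>
  define b' where "b' e = scal (2 * (of_nat D - of_nat e)) * b e" for e
  have b': "\<forall>e. b' e \<in> layer 0 e"
    using Suc by (simp add: b'_def layer_scal)
  have weight: "weight e - weight D = 2 * (of_nat D - of_nat e)" for e
    by (simp add: weight_def algebra_simps)
  have "(\<Sum>e<Suc D. gxi * b e - scal (weight e) * b e) \<in> K"
    using Suc.prems by (intro left_ideal_sum left_ideal xi_layer) auto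
  with N have "(gxi * ?w - scal (weight D) * ?w) -
      (\<Sum>e<Suc D. gxi * b e - scal (weight e) * b e) \<in> N"
    using Suc.prems by (intro left_ideal_diff[OF N(1)] left_ideal_mult[OF N(1)]) auto
  also have "(gxi * ?w - scal (weight D) * ?w) -
      (\<Sum>e<Suc D. gxi * b e - scal (weight e) * b e) = (\<Sum>e<Suc D. b' e)"
    unfolding b'_def weight[symmetric] scal_diff sum_distrib_left sum_subtractf[symmetric]
    by (intro sum.cong) (auto simp: algebra_simps)
  also have "\<dots> = (\<Sum>e<D. b' e)"
    by (simp add: b'_def)
  finally have *: "b' e \<in> N" if "e < D" for e
    using Suc.IH[OF b'] that by blast
  have below: "b e \<in> N" if "e < D" for e
    by (rule left_ideal_scal_cancel[OF N(1) *[OF that, unfolded b'_def]]) (use that in simp)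
  have "?w - (\<Sum>e<D. b e) \<in> N"
    using below by (intro left_ideal_diff[OF N(1)] left_ideal_sum[OF N(1)] Suc.prems) auto
  then have "b D \<in> N" by simp
  with below Suc.prems(3) show ?case by (auto simp: less_Suc_eq)
qed simp

section \<open>The left ideals form a chain\<close>

text \<open>
  A homogeneous element of \<open>N\<close> involves only monomials \<open>y^i x^l\<close> with \<open>l \<ge> J\<close>. The monomials with \<open>l = j\<close> are
  removed successively for \<open>j < J\<close>: the one of the given degree is either zero by the relations, when its
  \<open>y\<close>-exponent exceeds the length of the \<open>sl\<^sub>2\<close>-string, or a power of \<open>v\<close> turns the element into a
  multiple of \<open>x^j\<close>, whose coefficient must vanish because \<open>x^j\<close> is not in \<open>N\<close>.
\<close>

lemma first_x_power_bounds_layer: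
  assumes N: "left_ideal N" "K \<subseteq> N"
    and J: "\<And>j. j < J \<Longrightarrow> gx ^ j \<notin> N"
    and w: "w \<in> N" "w \<in> layer 0 d"
  shows "w \<in> layer J d"
proof -
  have "J \<le> Suc m"
    using J[of "Suc m"] rel_x N(2) by (meson not_le subsetD)
  have "w \<in> layer j d" if "j \<le> J" for j
    using that
  proof (induction j)
    case 0
    show ?case by (rule w)
  next
    case (Suc j)
    then have wj: "w \<in> layer j d" by simp
    show ?case
    proof (cases "j \<le> d")
      case False
      with wj show ?thesis by (simp add: layer_above_degree)
    next
      case True
      then obtain i where d: "d = i + j" by (metis le_add_diff_inverse2)
      from layer_top[OF wj] d obtain c b
        where b: "b \<in> layer (Suc j) (i + j)" and w_eq: "w = b + scal c * pbw i j" by auto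
      have "scal c * pbw i j \<in> K"
      proof (cases "i + 2 * j \<le> n + 2 * m")
        case True
        then obtain e where e: "e \<noteq> 0" "gv ^ i * pbw i j - scal e * gx ^ j \<in> K"
          using v_power_pbw by blast
        \<comment> \<open>\<open>v^i b\<close> has degree \<open>j\<close> but at least \<open>j + 1\<close> factors \<open>x\<close>, so it lies in \<open>K\<close>\<close>
        have "gv ^ i * b \<in> N"
          using v_power_layer[OF b] layer_above_degree[of j "Suc j"] N(2) by auto
        then have "gv ^ i * w - gv ^ i * b - scal c * (gv ^ i * pbw i j - scal e * gx ^ j) \<in> N"
          using K_mult[OF e(2), of "scal c"] left_ideal_mult[OF N(1) w(1), of "gv ^ i"] N(2)
          by (intro left_ideal_diff[OF N(1)]) auto
        then have "scal (c * e) * gx ^ j \<in> N"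
          by (simp add: w_eq algebra_simps scal_left_commute[of "gv ^ i"] scal_mult)
        then have "c * e = 0"
          using left_ideal_scal_cancel[OF N(1), of "c * e" "gx ^ j"] J[of j] Suc.prems by auto
        with e show ?thesis by (simp add: K_zero)
      next
        case False
        have "j \<le> m" using Suc.prems \<open>J \<le> Suc m\<close> by simp
        with False have i: "i = (i - (n + 2 * (m - j) + 1)) + (n + 2 * (m - j) + 1)" by simp
        have "pbw i j \<in> K"
          unfolding pbw_def
          by (subst i) (simp only: power_add[of gy "_ - _"] mult.assoc
              K_mult[OF rel_yx[OF \<open>j \<le> m\<close>]])
        then show ?thesis by (rule K_mult)
      qed
      with b d show ?thesis by (simp add: w_eq layer_add layer.K)
    qed
  qed
  then show ?thesis by simp
qed

lemma layer_subset_left_ideal: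
  assumes N: "left_ideal N" "K \<subseteq> N" and J: "gx ^ J \<in> N"
  shows "layer J d \<subseteq> N"
proof
  fix b assume "b \<in> layer J d"
  then show "b \<in> N"
  proof (induction rule: layer.induct)
    case (add_pbw b l i c)
    have "pbw i l = (gy ^ i * gx ^ (l - J)) * gx ^ J"
      using add_pbw by (simp add: pbw_def mult.assoc flip: power_add)
    then have "pbw i l \<in> N" using left_ideal_mult[OF N(1) J] by simp
    with add_pbw show ?case by (intro left_ideal_add[OF N(1)] left_ideal_mult[OF N(1)])
  qed (use N in auto)
qed

text \<open>
  The weight components of an element of \<open>B\<close> lie in \<open>B\<close>, hence in the layers number \<open>J\<close>, and those
  are generated by \<open>x^J\<close>.
\<close>

lemma left_ideal_subset:
  assumes A: "left_ideal A" "K \<subseteq> A" and B: "left_ideal B" "K \<subseteq> B"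
    and J: "gx ^ J \<in> A" "\<And>j. j < J \<Longrightarrow> gx ^ j \<notin> B"
  shows "B \<subseteq> A"
proof
  fix w assume w: "w \<in> B"
  obtain b D where b: "\<forall>d. b d \<in> layer 0 d" and w_eq: "w = (\<Sum>d<D. b d)"
    using graded_sums_UNIV[of w] unfolding graded_sums_def by blast
  have "b d \<in> A" if "d < D" for d
  proof -
    have "b d \<in> B" using weight_component[OF B b] w w_eq that by simp
    then have "b d \<in> layer J d"
      using first_x_power_bounds_layer[OF B J(2)] b by blast
    then show ?thesis using layer_subset_left_ideal[OF A J(1)] by blast
  qed
  then show "w \<in> A" by (auto simp: w_eq intro: left_ideal_sum[OF A(1)])
qed

lemma left_ideals_chain:
  assumes A: "left_ideal A" "K \<subseteq> A" and B: "left_ideal B" "K \<subseteq> B"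
  shows "A \<subseteq> B \<or> B \<subseteq> A"
proof -
  define J where "J N = (LEAST j. gx ^ j \<in> N)" for N :: "(jgen, 'k) free_alg set"
  have J: "gx ^ J N \<in> N" "\<And>j. j < J N \<Longrightarrow> gx ^ j \<notin> N" if "K \<subseteq> N" for N
    using that LeastI[of "\<lambda>j. gx ^ j \<in> N" "Suc m"] rel_x unfolding J_def
    by (auto simp del: power_Suc dest: not_less_Least)
  show ?thesis
  proof (cases "J A \<le> J B")
    case True
    then show ?thesis using left_ideal_subset[OF A B J(1)[OF A(2)]] J(2)[OF B(2)] by auto
  next
    case False
    then show ?thesis using left_ideal_subset[OF B A J(1)[OF B(2)]] J(2)[OF A(2)] by auto
  qed
qed

end

section \<open>A simple quotient of \<open>T(n,m)\<close>\<close>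

text \<open>
  On polynomials in \<open>t\<close>, let \<open>y\<close> be \<open>d/dt\<close>, \<open>\<xi>\<close> be \<open>2 t d/dt - k\<close> and \<open>v\<close> be
  \<open>- (t\<^sup>2 d/dt - k t) / 2\<close>. This is an action of \<open>sl\<^sub>2\<close> for which \<open>t^k\<close> is a highest weight vector of
  weight \<open>k\<close>; it generates the simple submodule of polynomials of degree at most \<open>k\<close>. Letting \<open>x\<close> and
  \<open>u\<close> act by zero and \<open>g\<close> by the identity makes the polynomials a module over the double. The whole
  space is kept because it is a type, and only the annihilator of \<open>t^k\<close> matters.
\<close>

fun sl2_op :: "nat \<Rightarrow> jgen \<Rightarrow> 'k::field_char_0 poly \<Rightarrow> 'k poly" where
  "sl2_op k Gen_u p = 0"
| "sl2_op k Gen_x p = 0"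
| "sl2_op k Gen_g p = p"
| "sl2_op k Gen_ginv p = p"
| "sl2_op k Gen_xi p = smult 2 (pCons 0 (pderiv p)) - smult (of_nat k) p"
| "sl2_op k Gen_y p = pderiv p"
| "sl2_op k Gen_v p = smult (- 1 / 2) (pCons 0 (pCons 0 (pderiv p)) - smult (of_nat k) (pCons 0 p))"

definition sl2_act :: "nat \<Rightarrow> (jgen, 'k::field_char_0) free_alg \<Rightarrow> 'k poly \<Rightarrow> 'k poly" where
  "sl2_act k f p = (\<Sum>w\<in>Poly_Mapping.keys f.
     smult (Poly_Mapping.lookup f w) (foldr (sl2_op k) (letters w) p))"

lemma sl2_op_add: "sl2_op k a (p + q) = sl2_op k a p + sl2_op k a q"
  by (cases a) (simp_all add: pderiv_add smult_add_right algebra_simps smult_diff_right)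

lemma sl2_op_smult: "sl2_op k a (smult c p) = smult c (sl2_op k a p)"
  by (cases a) (simp_all add: pderiv_smult smult_diff_right smult_add_right algebra_simps)

lemma foldr_sl2_op_linear:
  "foldr (sl2_op k) w (p + q) = foldr (sl2_op k) w p + foldr (sl2_op k) w q"
  "foldr (sl2_op k) w (smult c p) = smult c (foldr (sl2_op k) w p)"
  by (induction w) (simp_all add: sl2_op_add sl2_op_smult)

lemma sl2_act_superset:
  assumes "finite S" "Poly_Mapping.keys f \<subseteq> S"
  shows "sl2_act k f p = (\<Sum>w\<in>S. smult (Poly_Mapping.lookup f w) (foldr (sl2_op k) (letters w) p))"
  unfolding sl2_act_def using assms
  by (intro sum.mono_neutral_left) (auto simp: in_keys_iff)

lemma sl2_act_add_left: "sl2_act k (f + g) p = sl2_act k f p + sl2_act k g p"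
proof -
  let ?S = "Poly_Mapping.keys f \<union> Poly_Mapping.keys g"
  have "Poly_Mapping.keys (f + g) \<subseteq> ?S"
    by (rule keys_add)
  then show ?thesis
    by (simp add: sl2_act_superset[of ?S] lookup_add smult_add_left sum.distrib)
qed

lemma sl2_act_single: "sl2_act k (Poly_Mapping.single w c) p = smult c (foldr (sl2_op k) (letters w) p)"
  by (simp add: sl2_act_def)

lemma sl2_act_add_right: "sl2_act k f (p + q) = sl2_act k f p + sl2_act k f q"
  by (simp add: sl2_act_def foldr_sl2_op_linear smult_add_right sum.distrib)

lemma sl2_act_mult: "sl2_act k (f * g) p = sl2_act k f (sl2_act k g p)"
proof (induction f rule: free_alg_induct)
  case (single v c)
  show ?case
    by (induction g rule: free_alg_induct)
      (simp_all add: mult_single sl2_act_single plus_fword_def foldr_sl2_op_linear distrib_left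
        sl2_act_add_left sl2_act_add_right smult_add_right)
qed (simp add: distrib_right sl2_act_add_left)

lemma sl2_act_0 [simp]: "sl2_act k 0 p = 0"
  and sl2_act_0_right [simp]: "sl2_act k f 0 = 0"
  using sl2_act_add_left[of k 0 0 p] sl2_act_add_right[of k f 0 0] by simp_all

lemma sl2_act_uminus: "sl2_act k (- f) p = - sl2_act k f p"
  using sl2_act_add_left[of k f "- f" p] by (simp add: eq_neg_iff_add_eq_0 add.commute)

lemma sl2_act_diff: "sl2_act k (f - g) p = sl2_act k f p - sl2_act k g p"
  using sl2_act_add_left[of k f "- g" p] by (simp add: sl2_act_uminus)

lemma sl2_act_scal: "sl2_act k (scal c) p = smult c p"
  by (simp add: scal_def sl2_act_single zero_fword_def)

lemma sl2_act_gen: "sl2_act k (gen a) p = sl2_op k a p"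
  by (simp add: gen_def sl2_act_single)

lemma sl2_act_1 [simp]: "sl2_act k 1 p = p"
  by (metis sl2_act_scal scal_1 smult_1_left)

lemma sl2_act_numeral: "sl2_act k (numeral i) p = smult (numeral i) p"
  by (metis sl2_act_scal scal_numeral)

lemma sl2_act_of_nat: "sl2_act k (of_nat i) p = smult (of_nat i) p"
  by (metis sl2_act_scal scal_of_nat)

lemma sl2_act_power: "sl2_act k (f ^ i) p = (sl2_act k f ^^ i) p"
  by (induction i) (simp_all add: sl2_act_mult)

text \<open>
  Over an infinite field polynomials can be compared by their values, which reduces each relation to
  an identity in the field.
\<close>

lemma sl2_act_double_rels: "r \<in> double_rels \<Longrightarrow> sl2_act k r p = 0"
  unfolding double_rels_def Let_def
  by (elim insertE emptyE; simp only: sl2_act_diff sl2_act_add_left sl2_act_mult sl2_act_gen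
      sl2_act_scal sl2_act_numeral
      sl2_act_1 power2_eq_square sl2_op.simps; simp add: poly_eq_poly_eq_iff[symmetric] fun_eq_iff
      pderiv_pCons pderiv_diff pderiv_smult pderiv_minus; simp add: field_simps)

lemma sl2_act_double_ideal:
  fixes r :: "(jgen, 'k::field_char_0) free_alg"
  assumes "r \<in> double_ideal"
  shows "sl2_act k r p = 0"
proof -
  let ?I = "{r :: (jgen, 'k) free_alg. \<forall>p. sl2_act k r p = 0}"
  interpret ring free_alg_ring
    by (rule ring_free_alg)
  have minus: "inv\<^bsub>add_monoid free_alg_ring\<^esub> f = - f" for f :: "(jgen, 'k) free_alg"
    using minus_equality[of "- f" f] by (simp add: ring_of_type_algebra_def a_inv_def)
  have "subgroup ?I (add_monoid free_alg_ring)"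
  proof (rule subgroup.intro)
    show "inv\<^bsub>add_monoid free_alg_ring\<^esub> f \<in> ?I" if "f \<in> ?I" for f
      unfolding minus using that by (simp add: sl2_act_uminus)
  qed (auto simp: ring_of_type_algebra_def sl2_act_add_left)
  then have "ideal ?I free_alg_ring"
    by (rule idealI[OF ring_free_alg]) (auto simp: ring_of_type_algebra_def sl2_act_mult)
  moreover have "double_rels \<subseteq> ?I"
    using sl2_act_double_rels by auto
  ultimately have "double_ideal \<subseteq> ?I"
    unfolding double_ideal_def by (rule genideal_minimal)
  with assms show ?thesis by auto
qed

lemma pderiv_funpow_eq_0: "degree p < i \<Longrightarrow> (pderiv ^^ i) p = (0 :: 'k::field_char_0 poly)"
proof (induction i arbitrary: p)
  case (Suc i)
  show ?case
  proof (cases "degree p = 0")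
    case True
    then have "pderiv p = 0" by (simp add: pderiv_eq_0_iff)
    moreover have "(pderiv ^^ i) 0 = (0 :: 'k poly)" by (induction i) auto
    ultimately show ?thesis by (simp add: funpow_swap1)
  next
    case False
    then have "degree (pderiv p) < i" using Suc.prems by (simp add: degree_pderiv)
    from Suc.IH[OF this] show ?thesis by (simp add: funpow_swap1)
  qed
qed simp

text \<open>
  Euler's identity: \<open>t d/dt\<close> multiplies \<open>t^k\<close> by \<open>k\<close>.
\<close>

lemma euler_monom: "pCons 0 (pderiv (monom 1 k)) = smult (of_nat k) (monom 1 k)"
  by (cases k) (simp_all add: pderiv_monom smult_monom flip: monom_Suc)

lemma sl2_op_highest_weight:
  "sl2_op k Gen_xi (monom 1 k) = smult (of_nat k) (monom 1 k)"
  "sl2_op k Gen_v (monom 1 k) = 0"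
  by (simp_all add: euler_monom flip: smult_diff_left)

text \<open>
  The annihilator of the highest weight vector \<open>t^k\<close>, \<open>k = n + 2m\<close>, contains all relations of
  \<open>T(n,m)\<close>: those with a factor \<open>x\<close> because \<open>x\<close> acts by zero, and \<open>y^{k+1}\<close> because \<open>t^k\<close> vanishes
  after \<open>k + 1\<close> differentiations.
\<close>

lemma ex_proper_T_ideal:
  "\<exists>K :: (jgen, 'k::field_char_0) free_alg set. T_ideal K n m \<and> 1 \<notin> K"
proof (intro exI conjI)
  let ?k = "n + 2 * m"
  let ?K = "{f :: (jgen, 'k) free_alg. sl2_act ?k f (monom 1 ?k) = 0}"
  show "1 \<notin> ?K" by simp
  show "T_ideal ?K n m"
  proof
    show "left_ideal ?K"
      by (simp add: left_ideal_def sl2_act_add_left sl2_act_mult)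
    show "double_ideal \<subseteq> ?K"
      using sl2_act_double_ideal by auto
    have y: "sl2_act ?k (gy ^ (n + 2 * (m - j) + 1) * gx ^ j) (monom 1 ?k :: 'k poly) = 0" for j
    proof (cases j)
      case 0
      have "sl2_act ?k gy = (pderiv :: 'k poly \<Rightarrow> 'k poly)"
        by (auto simp: sl2_act_gen)
      then show ?thesis
        using 0 pderiv_funpow_eq_0[of "monom 1 ?k :: 'k poly" "?k + 1"]
        by (simp add: sl2_act_power degree_monom_eq del: funpow.simps power_Suc)
    qed (simp add: sl2_act_mult sl2_act_gen)
    show "T_rels n m \<subseteq> ?K"
      unfolding T_rels_def using y
      by (auto simp: sl2_act_diff sl2_act_gen sl2_act_mult sl2_act_of_nat sl2_op_highest_weight
          simp del: of_nat_add of_nat_mult sl2_op.simps(5,7))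
  qed
qed

section \<open>Submodules of \<open>T(n,m)\<close> as left ideals of the free algebra\<close>

lemma carrier_jordan_double: "carrier jordan_double = range dcls"
  by (auto simp: jordan_double_def FactRing_def dcls_def A_RCOSETS_def' ring_of_type_algebra_def)

lemma dcls_hom:
  "(dcls :: (jgen, 'k::field) free_alg \<Rightarrow> _) \<in> ring_hom free_alg_ring jordan_double"
  using ideal.rcos_ring_hom[OF double_ideal_ideal]
  by (simp add: jordan_double_def dcls_def[abs_def])

lemma dcls_add: "dcls f \<oplus>\<^bsub>jordan_double\<^esub> dcls g = dcls (f + g)"
  and dcls_mult: "dcls f \<otimes>\<^bsub>jordan_double\<^esub> dcls g = dcls (f * g)"
  using ring_hom_add[OF dcls_hom, of f g] ring_hom_mult[OF dcls_hom, of f g]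
  by (simp_all add: ring_of_type_algebra_def)

lemma dcls_zero: "\<zero>\<^bsub>jordan_double\<^esub> = (dcls 0 :: (jgen, 'k::field) free_alg set)"
  using ring_hom_zero[OF dcls_hom[where 'k = 'k] ring_free_alg ring_jordan_double]
  by (simp add: ring_of_type_algebra_def)

lemma dcls_eqD: "dcls f = dcls g \<Longrightarrow> f - g \<in> double_ideal"
proof -
  interpret ideal double_ideal free_alg_ring
    by (rule double_ideal_ideal)
  assume "dcls f = dcls g"
  moreover have "f \<in> dcls f"
    unfolding dcls_def by (rule a_rcos_self) (simp add: ring_of_type_algebra_def)
  ultimately show ?thesis
    by (auto simp: dcls_def a_r_coset_def' ring_of_type_algebra_def)
qed

lemma dcls_eq_zero: "r \<in> double_ideal \<Longrightarrow> dcls r = dcls 0"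
proof -
  interpret ideal double_ideal free_alg_ring
    by (rule double_ideal_ideal)
  assume "r \<in> double_ideal"
  then have "dcls r = double_ideal"
    unfolding dcls_def by (rule a_coset_join2[OF _ a_subgroup, rotated])
      (simp add: ring_of_type_algebra_def)
  then show ?thesis using dcls_zero by (simp add: jordan_double_def FactRing_def)
qed

text \<open>
  The submodule of the regular module of the double by which \<open>T(n,m)\<close> is the quotient.
\<close>

definition T_relations :: "nat \<Rightarrow> nat \<Rightarrow> (jgen, 'k::field) free_alg set set" where
  "T_relations n m = gen_submodule jordan_double (regular_module jordan_double) (dcls ` T_rels n m)"

text \<open>
  The element \<open>f \<cdot> z\<close> of \<open>T(n,m)\<close>, for \<open>f\<close> in the free algebra.
\<close>

definition T_elem :: "nat \<Rightarrow> nat \<Rightarrow> (jgen, 'k::field) free_alg \<Rightarrow> (jgen, 'k) free_alg set set" where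
  "T_elem n m f = T_relations n m +>\<^bsub>regular_module jordan_double\<^esub> dcls f"

lemma left_module_regular_double: "left_module jordan_double (regular_module jordan_double)"
  by (rule left_module_regular[OF ring_jordan_double])

lemma T_module_quotient:
  "T_module n m = quotient_module (regular_module jordan_double) (T_relations n m)"
  by (simp add: T_module_def presented_cyclic_module_def T_relations_def)

lemma submodule_T_relations: "submodule (T_relations n m) jordan_double (regular_module jordan_double)"
proof -
  interpret left_module jordan_double "regular_module jordan_double"
    by (rule left_module_regular_double)
  show ?thesis
    unfolding T_relations_def
    by (rule gen_submodule_submodule) (auto simp: regular_module_def carrier_jordan_double)
qed

lemma abelian_subgroup_T_relations:
  "abelian_subgroup (T_relations n m :: (jgen, 'k::field) free_alg set set) (regular_module jordan_double)"
proof -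
  interpret left_module jordan_double "regular_module jordan_double"
    by (rule left_module_regular_double)
  show ?thesis
    using submodule.axioms(1)[OF submodule_T_relations]
    by (intro abelian_subgroupI3 additive_subgroup.intro) (auto simp: M.abelian_group_axioms)
qed

lemma carrier_T_module: "carrier (T_module n m) = range (T_elem n m)"
  by (auto simp: T_module_quotient quotient_module_def A_RCOSETS_def' T_elem_def
      carrier_jordan_double regular_module_def)

lemma T_elem_add: "T_elem n m f \<oplus>\<^bsub>T_module n m\<^esub> T_elem n m g = T_elem n m (f + g)"
  using abelian_subgroup.a_rcos_sum[OF abelian_subgroup_T_relations, of "dcls f" "dcls g"]
  by (simp add: T_module_quotient quotient_module_def T_elem_def regular_module_def
      carrier_jordan_double dcls_add)

lemma T_elem_smult: "dcls f \<odot>\<^bsub>T_module n m\<^esub> T_elem n m g = T_elem n m (f * g)"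
  using left_module.smult_coset[OF left_module_regular_double submodule_T_relations,
      of "dcls f" "dcls g"]
  by (simp add: T_module_quotient T_elem_def carrier_jordan_double dcls_mult)
    (simp add: regular_module_def carrier_jordan_double dcls_mult)

lemma T_elem_eq_zero_iff: "T_elem n m f = \<zero>\<^bsub>T_module n m\<^esub> \<longleftrightarrow> dcls f \<in> T_relations n m"
proof -
  interpret abelian_subgroup "T_relations n m" "regular_module jordan_double"
    by (rule abelian_subgroup_T_relations)
  have "dcls f \<in> carrier (regular_module jordan_double)"
    by (simp add: regular_module_def carrier_jordan_double)
  then show ?thesis
    using a_rcos_self[of "dcls f"] a_coset_join2[OF _ a_subgroup, of "dcls f"]
    by (auto simp: T_module_quotient quotient_module_def T_elem_def)
qed

lemma T_elem_rels:
  fixes r :: "(jgen, 'k::field) free_alg"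
  assumes r: "r \<in> double_ideal \<union> T_rels n m"
  shows "T_elem n m r = \<zero>\<^bsub>T_module n m\<^esub>"
proof -
  have "(dcls 0 :: (jgen, 'k) free_alg set) \<in> T_relations n m"
    using additive_subgroup.zero_closed[OF abelian_subgroup.axioms(1)[OF
        abelian_subgroup_T_relations[where 'k = 'k]]]
    by (simp add: regular_module_def dcls_zero)
  moreover have "dcls ` T_rels n m \<subseteq> T_relations n m"
    unfolding T_relations_def gen_submodule_def by blast
  ultimately show ?thesis
    using r dcls_eq_zero[of r] unfolding T_elem_eq_zero_iff by auto
qed

lemma T_ideal_submodule:
  fixes N :: "(jgen, 'k::field_char_0) free_alg set set set"
  assumes "submodule N jordan_double (T_module n m)"
  shows "T_ideal {f. T_elem n m f \<in> N} n m"
proof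
  interpret N: submodule N jordan_double "T_module n m" by fact
  have zero: "\<zero>\<^bsub>T_module n m\<^esub> \<in> N" using N.one_closed by simp
  show "double_ideal \<subseteq> {f. T_elem n m f \<in> N}" and "T_rels n m \<subseteq> {f. T_elem n m f \<in> N}"
    by (auto simp: T_elem_rels zero)
  have "(0 :: (jgen, 'k) free_alg) \<in> double_ideal"
    using additive_subgroup.zero_closed[OF ideal.axioms(1)[OF double_ideal_ideal[where 'k = 'k]]]
    by (simp add: ring_of_type_algebra_def)
  then have "T_elem n m 0 \<in> N"
    by (simp add: T_elem_rels zero)
  moreover have "T_elem n m (f + g) \<in> N" if "T_elem n m f \<in> N" "T_elem n m g \<in> N" for f g
    using N.m_closed[OF that] by (simp add: T_elem_add)
  moreover have "T_elem n m (f * g) \<in> N" if "T_elem n m g \<in> N" for f g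
    using N.smult_closed[OF _ that, of "dcls f"] by (simp add: carrier_jordan_double T_elem_smult)
  ultimately show "left_ideal {f. T_elem n m f \<in> N}"
    by (simp add: left_ideal_def)
qed

text \<open>
  Submodules are compared through their preimages, and the smaller left ideal modulo which to
  compute can be taken to be the intersection of the two.
\<close>

lemma uniserial_T_module:
  "uniserial (jordan_double :: (jgen, 'k::field_char_0) free_alg set ring) (T_module n m)"
  unfolding uniserial_def
proof (intro allI impI)
  fix A B :: "(jgen, 'k) free_alg set set set"
  assume AB: "submodule A jordan_double (T_module n m)" "submodule B jordan_double (T_module n m)"
  let ?A = "{f. T_elem n m f \<in> A}" and ?B = "{f. T_elem n m f \<in> B}"
  have "T_ideal (?A \<inter> ?B) n m"
    using T_ideal_submodule[OF AB(1)] T_ideal_submodule[OF AB(2)]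
    by (auto simp: T_ideal_def left_ideal_def)
  then have "?A \<subseteq> ?B \<or> ?B \<subseteq> ?A"
    using T_ideal_submodule[OF AB(1)] T_ideal_submodule[OF AB(2)]
    by (intro T_ideal.left_ideals_chain[of "?A \<inter> ?B" n m]) (simp_all add: T_ideal_def)
  moreover have "A \<subseteq> range (T_elem n m)" "B \<subseteq> range (T_elem n m)"
    using subgroup.subset[OF submodule.axioms(1)[OF AB(1)]]
      subgroup.subset[OF submodule.axioms(1)[OF AB(2)]]
    by (simp_all add: carrier_T_module)
  ultimately show "A \<subseteq> B \<or> B \<subseteq> A" by blast
qed

lemma submodule_dcls_image:
  fixes K :: "(jgen, 'k::field) free_alg set"
  assumes K: "left_ideal K"
  shows "submodule (dcls ` K) jordan_double (regular_module jordan_double)"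
proof -
  interpret left_module jordan_double "regular_module jordan_double :: (_, (jgen, 'k) free_alg set) module"
    by (rule left_module_regular_double)
  have minus: "inv\<^bsub>add_monoid (regular_module jordan_double)\<^esub> dcls f = dcls (- f)"
    for f :: "(jgen, 'k) free_alg"
  proof -
    have "\<ominus>\<^bsub>regular_module jordan_double\<^esub> dcls f = dcls (- f)"
      by (rule M.minus_equality)
        (simp_all add: regular_module_def carrier_jordan_double dcls_add dcls_zero)
    then show ?thesis by (simp add: a_inv_def)
  qed
  show ?thesis
  proof (intro submodule.intro submodule_axioms.intro subgroup.intro)
    show "dcls ` K \<subseteq> carrier (add_monoid (regular_module jordan_double))"
      by (auto simp: regular_module_def carrier_jordan_double)
    show "a \<otimes>\<^bsub>add_monoid (regular_module jordan_double)\<^esub> b \<in> dcls ` K"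
      if "a \<in> dcls ` K" "b \<in> dcls ` K" for a b
      using that left_ideal_add[OF K] by (auto simp: regular_module_def dcls_add)
    show "\<one>\<^bsub>add_monoid (regular_module jordan_double)\<^esub> \<in> dcls ` K"
      using left_ideal_zero[OF K] by (auto simp: regular_module_def dcls_zero)
    show "inv\<^bsub>add_monoid (regular_module jordan_double)\<^esub> a \<in> dcls ` K" if "a \<in> dcls ` K" for a
      using that left_ideal_uminus[OF K] by (auto simp: minus)
    show "a \<odot>\<^bsub>regular_module jordan_double\<^esub> b \<in> dcls ` K"
      if "a \<in> carrier jordan_double" "b \<in> dcls ` K" for a b
      using that left_ideal_mult[OF K] by (auto simp: regular_module_def carrier_jordan_double dcls_mult)
  qed
qed

text \<open>
  The relations of \<open>T(n,m)\<close> generate a left ideal inside the image of any \<open>K\<close> as above, and a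
  proper \<open>K\<close> exists.
\<close>

lemma T_module_nonzero:
  "T_elem n m (1 :: (jgen, 'k::field_char_0) free_alg) \<noteq> \<zero>\<^bsub>T_module n m\<^esub>"
proof
  obtain K :: "(jgen, 'k) free_alg set" where "T_ideal K n m" and K1: "1 \<notin> K"
    using ex_proper_T_ideal by blast
  then interpret T_ideal K n m by simp
  assume "T_elem n m (1 :: (jgen, 'k) free_alg) = \<zero>\<^bsub>T_module n m\<^esub>"
  then have "dcls 1 \<in> (T_relations n m :: (jgen, 'k) free_alg set set)"
    by (simp add: T_elem_eq_zero_iff)
  moreover have "(T_relations n m :: (jgen, 'k) free_alg set set) \<subseteq> dcls ` K"
    using submodule_dcls_image[OF left_ideal] T_rels_subset
    unfolding T_relations_def gen_submodule_def by blast
  ultimately obtain f where f: "f \<in> K" "dcls 1 = dcls f" by blast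
  then have "(1 - f) + f \<in> K"
    using dcls_eqD double_ideal_subset by (intro K_add) auto
  with K1 show False by simp
qed

text \<open>
  Of two comparable submodules one is their intersection.
\<close>

lemma (in left_module) uniserial_imp_indecomposable:
  assumes "uniserial R M" "carrier M \<noteq> {\<zero>\<^bsub>M\<^esub>}"
  shows "indecomposable R M"
  using assms unfolding indecomposable_def uniserial_def by blast

theorem proposition4p5:
  fixes n m :: nat
  shows
        "uniserial (jordan_double :: (jgen, 'k :: {alg_closed_field, field_char_0}) free_alg set ring)
           (T_module n m) \<and>
         indecomposable (jordan_double :: (jgen, 'k) free_alg set ring) (T_module n m)"
proof
  show uniserial: "uniserial (jordan_double :: (jgen, 'k) free_alg set ring) (T_module n m)"
    by (rule uniserial_T_module)
  have "carrier (T_module n m) \<noteq> {\<zero>\<^bsub>T_module n m :: (_, (jgen, 'k) free_alg set set) module\<^esub>}"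
    using T_module_nonzero[where 'k = 'k, of n m] unfolding carrier_T_module
    by (metis rangeI singletonD)
  with uniserial show "indecomposable (jordan_double :: (jgen, 'k) free_alg set ring) (T_module n m)"
    by (rule left_module.uniserial_imp_indecomposable[OF left_module_T_module])
qed

end
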